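(* Let $k\geq 5$ be an integer. Every simple graph $G$ on $n$ vertices contains at most $\dfrac{27\,n^{k}}{k^{k}}$ induced copies of the double loop graph $DLG(1,2)$ of order $k$; that is, the number of $k$-element subsets of $V(G)$ whose induced subgraph in $G$ is isomorphic to $DLG(1,2)$ of order $k$ is at most $\dfrac{27\,n^{k}}{k^{k}}$.
   Context: All graphs are finite and simple. For an integer $k\ge 5$, the double loop graph $DLG(1,2)$ of order $k$ has as vertices the integers modulo $k$, with each vertex $i$ joined to the four vertices $i\pm 1 \pmod{k}$ and $i\pm 2\pmod{k}$. The number of induced copies of a $k$-vertex graph $H$ in a graph $G$ is the number of $k$-element vertex subsets of $G$ that induce a subgraph isomorphic to $H$. *)

theory Defs
  imports Complex_Main "HOL-Number_Theory.Cong" "Graph_Theory.Graph_Theory"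
begin

text \<open>
  Graphs are the symmetric, loop-free digraphs without parallel arcs of the locale
  \<^locale>\<open>graph\<close>: an undirected edge is a pair of opposite arcs.
\<close>

text \<open>
  The integers modulo k are represented by their residues in \<open>{0..<k}\<close>. An unordered
  edge is adjacency in either direction, so both signs of each step are listed.
\<close>

definition double_loop_graph :: "nat \<Rightarrow> int \<Rightarrow> int \<Rightarrow> (int, int \<times> int) pre_digraph" where
  "double_loop_graph k a b =
     with_proj \<lparr> pverts = {0..<int k},
       parcs = {(i, j). i \<in> {0..<int k} \<and> j \<in> {0..<int k} \<and>
         ([j = i + a] (mod int k) \<or> [j = i - a] (mod int k) \<or>
          [j = i + b] (mod int k) \<or> [j = i - b] (mod int k))} \<rparr>"

definition induced_copies :: "('c, 'd) pre_digraph \<Rightarrow> ('a, 'b) pre_digraph \<Rightarrow> nat" where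
  "induced_copies H G =
     card {S. S \<subseteq> verts G \<and> card S = card (verts H) \<and> digraph_iso (G \<restriction> S) H}"

lemma card_verts_double_loop_graph: "card (verts (double_loop_graph k a b)) = k"
  by (simp add: double_loop_graph_def)

lemma graph_double_loop_graph_1_2:
  assumes "k \<ge> 5"
  shows "graph (double_loop_graph k 1 2)"
proof -
  define D where "D = \<lparr> pverts = {0..<int k},
       parcs = {(i, j). i \<in> {0..<int k} \<and> j \<in> {0..<int k} \<and>
         ([j = i + 1] (mod int k) \<or> [j = i - 1] (mod int k) \<or>
          [j = i + 2] (mod int k) \<or> [j = i - 2] (mod int k))} \<rparr>"
  have fin: "finite (parcs D)"
    by (rule finite_subset[of _ "{0..<int k} \<times> {0..<int k}"]) (auto simp: D_def)
  have noloop: "\<not> [i = i + c] (mod int k)" if "c \<in> {1, -1, 2, -2}" for i c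
    using that assms zdvd_not_zless[of 1 "int k"] zdvd_not_zless[of 2 "int k"]
    by (auto simp: cong_iff_dvd_diff)
  have sgn: "[j = i + c] (mod int k) \<longleftrightarrow> [i = j - c] (mod int k)" for i j c
    by (auto simp: cong_iff_dvd_diff dvd_diff_commute[of "int k"] algebra_simps)
  have "pair_graph D"
  proof unfold_locales
    show "finite (parcs D)" by (fact fin)
    show "fst e \<noteq> snd e" if "e \<in> parcs D" for e
      using that noloop[of 1] noloop[of "-1"] noloop[of 2] noloop[of "-2"]
      by (auto simp: D_def)
    show "symmetric (with_proj D)"
      using sgn[of _ _ 1] sgn[of _ _ 2]
      by (auto simp: symmetric_def D_def arcs_ends_conv intro!: symI)
  qed (auto simp: D_def)
  then interpret pair_graph D .
  show ?thesis
    unfolding double_loop_graph_def D_def[symmetric] by unfold_locales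
qed

lemma digraph_iso_iff_adjacency:
  assumes "nomulti_digraph G" "nomulti_digraph H"
  shows "digraph_iso G H \<longleftrightarrow>
    (\<exists>f. bij_betw f (verts G) (verts H) \<and>
       (\<forall>u \<in> verts G. \<forall>v \<in> verts G. u \<rightarrow>\<^bsub>G\<^esub> v \<longleftrightarrow> f u \<rightarrow>\<^bsub>H\<^esub> f v))"
    (is "?L \<longleftrightarrow> (\<exists>f. ?P f)")
proof
  interpret G: nomulti_digraph G by fact
  assume ?L
  then obtain h where h: "G.digraph_isomorphism h" and H: "H = app_iso h G"
    by (auto simp: digraph_iso_def)
  have inj: "inj_on (iso_verts h) (verts G)"
    and ends: "\<And>a. a \<in> arcs G \<Longrightarrow> iso_verts h (tail G a) = iso_tail h (iso_arcs h a) \<and>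
                 iso_verts h (head G a) = iso_head h (iso_arcs h a)"
    using h by (auto simp: G.digraph_isomorphism_def)
  have "?P (iso_verts h)"
  proof (intro conjI ballI)
    show "bij_betw (iso_verts h) (verts G) (verts H)"
      using inj by (simp add: H bij_betw_def)
    fix u v assume uv: "u \<in> verts G" "v \<in> verts G"
    have "iso_verts h u \<rightarrow>\<^bsub>H\<^esub> iso_verts h v \<longleftrightarrow>
      (\<exists>a \<in> arcs G. iso_verts h u = iso_verts h (tail G a) \<and> iso_verts h v = iso_verts h (head G a))"
      using ends by (auto simp: H arcs_ends_conv)
    also have "\<dots> \<longleftrightarrow> u \<rightarrow>\<^bsub>G\<^esub> v"
      using uv by (auto simp: arcs_ends_conv inj_on_eq_iff[OF inj])
    finally show "u \<rightarrow>\<^bsub>G\<^esub> v \<longleftrightarrow> iso_verts h u \<rightarrow>\<^bsub>H\<^esub> iso_verts h v" by simp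
  qed
  then show "\<exists>f. ?P f" by blast
next
  interpret G: nomulti_digraph G by fact
  interpret H: nomulti_digraph H by fact
  assume "\<exists>f. ?P f"
  then obtain f where bij: "bij_betw f (verts G) (verts H)"
    and adj: "\<And>u v. u \<in> verts G \<Longrightarrow> v \<in> verts G \<Longrightarrow> u \<rightarrow>\<^bsub>G\<^esub> v \<longleftrightarrow> f u \<rightarrow>\<^bsub>H\<^esub> f v"
    by blast
  have inj: "inj_on f (verts G)" and img: "f ` verts G = verts H"
    using bij by (auto simp: bij_betw_def)
  have "\<exists>b \<in> arcs H. tail H b = f (tail G a) \<and> head H b = f (head G a)" if "a \<in> arcs G" for a
  proof -
    have "tail G a \<rightarrow>\<^bsub>G\<^esub> head G a" using that by (auto simp: arcs_ends_conv)
    with adj that have "f (tail G a) \<rightarrow>\<^bsub>H\<^esub> f (head G a)" by simp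
    then show ?thesis by (auto simp: arcs_ends_conv)
  qed
  then obtain g where g: "\<And>a. a \<in> arcs G \<Longrightarrow>
      g a \<in> arcs H \<and> tail H (g a) = f (tail G a) \<and> head H (g a) = f (head G a)"
    by metis
  define h where "h = \<lparr> iso_verts = f, iso_arcs = g, iso_head = head H, iso_tail = tail H \<rparr>"
  have "inj_on g (arcs G)"
  proof (rule inj_onI)
    fix a b assume ab: "a \<in> arcs G" "b \<in> arcs G" "g a = g b"
    then have "f (tail G a) = f (tail G b)" "f (head G a) = f (head G b)"
      using g by metis+
    then have "tail G a = tail G b" "head G a = head G b"
      using ab inj by (auto simp: inj_on_eq_iff)
    then show "a = b" using ab G.no_multi_arcs by (auto simp: arc_to_ends_def)
  qed
  then have "G.digraph_isomorphism h"
    using inj g G.wf_digraph by (auto simp: G.digraph_isomorphism_def h_def)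
  moreover have "g ` arcs G = arcs H"
  proof (intro equalityI subsetI)
    fix b assume b: "b \<in> arcs H"
    then have "tail H b \<in> f ` verts G" "head H b \<in> f ` verts G" using img by auto
    then obtain u v where uv: "u \<in> verts G" "v \<in> verts G" "f u = tail H b" "f v = head H b"
      by (metis imageE)
    have "tail H b \<rightarrow>\<^bsub>H\<^esub> head H b" using b by (auto simp: arcs_ends_conv)
    then have "u \<rightarrow>\<^bsub>G\<^esub> v" using adj uv by simp
    then obtain a where "a \<in> arcs G" "tail G a = u" "head G a = v"
      by (auto simp: arcs_ends_conv)
    then have "a \<in> arcs G" "g a = b"
      using g[of a] b uv H.no_multi_arcs[of "g a" b] by (auto simp: arc_to_ends_def)
    then show "b \<in> g ` arcs G" by blast
  qed (use g in auto)
  then have "H = app_iso h G"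
    by (simp add: app_iso_def h_def img)
  ultimately show ?L by (auto simp: digraph_iso_def)
qed

end

theory Submission
  imports Defs
begin

text \<open>
  Each induced copy is counted through its labellings, the lists of \<open>k\<close> vertices of \<open>G\<close> with
  the adjacencies of the double loop graph. Consider the random process that builds such a
  list greedily, always choosing uniformly among the vertices with the prescribed adjacency to
  all earlier ones. The probabilities of the resulting lists sum to at most 1
  (\<open>sum_greedy_weight_le_1\<close>), so a lower bound for these probabilities bounds the number of
  lists, and every copy has at least as many labellings as the loop graph has automorphisms
  (\<open>induced_copies_mult_automorphisms_le\<close>).

  A single list can be very unlikely, but not all \<open>k\<close> rotations of it can be. The reciprocal of
  the probability of a list is the product of the numbers of candidates in the \<open>k\<close> steps.
  A fixed vertex \<open>w\<close> of \<open>G\<close> cannot be a candidate often: away from the ends of the list, a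
  candidate must be adjacent to exactly the last two vertices chosen, so for each rotation the
  first neighbours of \<open>w\<close> among the vertices of the list determine the only step in which
  \<open>w\<close> qualifies. Steps 1 and 2, and the last two, where the list closes up to a cycle, need
  separate accounting: with scales 4, 2 and 2 for the steps 1, 2 and \<open>k - 1\<close>, every vertex
  contributes at most \<open>k\<close> in total over all rotations (\<open>sum_windows_le\<close>). By an inequality of
  the type of arithmetic and geometric means, the probabilities of the \<open>k\<close> rotations then sum
  to at least \<open>k (k - 1) ^ (k - 1) / (16 n ^ k)\<close>, hence to at least \<open>k ^ k / (54 n ^ k)\<close>.
  There are thus at most \<open>54 k n ^ k / k ^ k\<close> lists, and dividing by the \<open>2 k\<close> dihedral symmetries
  gives the bound.

  The accounting for the closing steps requires \<open>k \<ge> 7\<close>. For \<open>k = 5\<close> the graph is complete and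
  counting all 5-element sets suffices. For \<open>k = 6\<close> it is the octahedron, which has 48
  automorphisms, and a direct estimate of the candidate numbers is enough.
\<close>

section \<open>Building labelled copies one vertex at a time\<close>

text \<open>
  Graphs are handled through a vertex set \<open>V\<close> and an adjacency relation \<open>R\<close>; \<open>P s t\<close>
  prescribes whether the vertices in positions \<open>s\<close> and \<open>t\<close> of a list are adjacent.
\<close>

definition extensions :: "'a set \<Rightarrow> ('a \<Rightarrow> 'a \<Rightarrow> bool) \<Rightarrow> (nat \<Rightarrow> nat \<Rightarrow> bool) \<Rightarrow> 'a list \<Rightarrow> 'a set" where
  "extensions V R P xs = {w \<in> V. \<forall>t < length xs. R (xs ! t) w \<longleftrightarrow> P t (length xs)}"

text \<open>
  Lists with repeated vertices are included: they can only enlarge a set whose size is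
  bounded from above.
\<close>

definition labelled_copies :: "'a set \<Rightarrow> ('a \<Rightarrow> 'a \<Rightarrow> bool) \<Rightarrow> (nat \<Rightarrow> nat \<Rightarrow> bool) \<Rightarrow> nat \<Rightarrow> 'a list set" where
  "labelled_copies V R P k =
     {xs. length xs = k \<and> (\<forall>j < k. xs ! j \<in> extensions V R P (take j xs))}"

text \<open>
  The probability that the list is produced by the random process which always appends a
  uniformly chosen admissible vertex.
\<close>

definition greedy_weight :: "'a set \<Rightarrow> ('a \<Rightarrow> 'a \<Rightarrow> bool) \<Rightarrow> (nat \<Rightarrow> nat \<Rightarrow> bool) \<Rightarrow> 'a list \<Rightarrow> real" where
  "greedy_weight V R P xs = (\<Prod>j < length xs. 1 / real (card (extensions V R P (take j xs))))"

lemma labelled_copies_0: "labelled_copies V R P 0 = {[]}"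
  by (auto simp: labelled_copies_def)

lemma labelled_copies_Suc:
  "labelled_copies V R P (Suc k) =
     (\<lambda>(xs, w). xs @ [w]) ` (SIGMA xs : labelled_copies V R P k. extensions V R P xs)"
  (is "?L = ?F ` ?S")
proof (intro equalityI subsetI)
  fix ys assume ys: "ys \<in> ?L"
  then have len: "length ys = Suc k"
    and ext: "\<And>j. j < Suc k \<Longrightarrow> ys ! j \<in> extensions V R P (take j ys)"
    by (auto simp: labelled_copies_def)
  have eq: "ys = take k ys @ [ys ! k]"
    using len by (metis lessI take_Suc_conv_app_nth take_all_iff le_refl)
  have "take k ys \<in> labelled_copies V R P k"
    using len ext by (auto simp: labelled_copies_def min_def)
  moreover have "ys ! k \<in> extensions V R P (take k ys)"
    using ext by simp
  ultimately show "ys \<in> ?F ` ?S"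
    using eq by (intro image_eqI[where x = "(take k ys, ys ! k)"]) auto
next
  fix ys assume "ys \<in> ?F ` ?S"
  then obtain xs w where ys: "ys = xs @ [w]" and xs: "xs \<in> labelled_copies V R P k"
    and w: "w \<in> extensions V R P xs" by auto
  have "ys ! j \<in> extensions V R P (take j ys)" if "j < Suc k" for j
    using that xs w by (cases "j = k") (auto simp: ys labelled_copies_def nth_append)
  with xs show "ys \<in> ?L" by (auto simp: labelled_copies_def ys)
qed

lemma finite_extensions: "finite V \<Longrightarrow> finite (extensions V R P xs)"
  by (auto simp: extensions_def)

lemma finite_labelled_copies: "finite V \<Longrightarrow> finite (labelled_copies V R P k)"
  by (induction k)
    (auto simp: labelled_copies_0 labelled_copies_Suc finite_extensions)

lemma greedy_weight_snoc:
  "greedy_weight V R P (xs @ [w]) = greedy_weight V R P xs * (1 / real (card (extensions V R P xs)))"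
  by (simp add: greedy_weight_def)

lemma greedy_weight_nonneg: "greedy_weight V R P xs \<ge> 0"
  by (simp add: greedy_weight_def prod_nonneg)

text \<open>
  The weights are probabilities of disjoint events. The sum may stay below 1, since the
  process can reach a list without extensions.
\<close>

lemma sum_greedy_weight_le_1:
  assumes "finite V"
  shows "(\<Sum>xs \<in> labelled_copies V R P k. greedy_weight V R P xs) \<le> 1"
proof (induction k)
  case 0
  then show ?case by (simp add: labelled_copies_0 greedy_weight_def)
next
  case (Suc k)
  let ?L = "labelled_copies V R P k" and ?E = "extensions V R P"
  let ?W = "greedy_weight V R P"
  have inj: "inj_on (\<lambda>(xs, w). xs @ [w]) (SIGMA xs : ?L. ?E xs)"
    by (auto simp: inj_on_def)
  have "(\<Sum>xs \<in> labelled_copies V R P (Suc k). ?W xs)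
      = (\<Sum>(xs, w) \<in> (SIGMA xs : ?L. ?E xs). ?W xs * (1 / real (card (?E xs))))"
    unfolding labelled_copies_Suc sum.reindex[OF inj]
    by (intro sum.cong) (auto simp: greedy_weight_snoc)
  also have "\<dots> = (\<Sum>xs \<in> ?L. \<Sum>w \<in> ?E xs. ?W xs * (1 / real (card (?E xs))))"
    using assms by (subst sum.Sigma) (auto simp: finite_labelled_copies finite_extensions)
  also have "\<dots> \<le> (\<Sum>xs \<in> ?L. ?W xs)"
    by (intro sum_mono) (auto simp: greedy_weight_nonneg)
  finally show ?case using Suc by simp
qed

text \<open>
  For symmetric relations the condition imposed position by position does not depend on the
  order of the positions. This is what makes automorphisms of the pattern act on the lists.
\<close>

lemma labelled_copies_iff:
  assumes R: "\<And>u v. R u v \<Longrightarrow> R v u" and P: "\<And>s t. P s t \<Longrightarrow> P t s"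
  shows "xs \<in> labelled_copies V R P k \<longleftrightarrow> length xs = k \<and> set xs \<subseteq> V \<and>
    (\<forall>s < k. \<forall>t < k. s \<noteq> t \<longrightarrow> (R (xs ! s) (xs ! t) \<longleftrightarrow> P s t))" (is "?l \<longleftrightarrow> ?r")
proof
  assume l: ?l
  then have len: "length xs = k" by (simp add: labelled_copies_def)
  have V: "xs ! t \<in> V" if "t < k" for t
    using l that by (auto simp: labelled_copies_def extensions_def)
  have lt: "R (xs ! s) (xs ! t) \<longleftrightarrow> P s t" if "s < t" "t < k" for s t
    using l that by (auto simp: labelled_copies_def extensions_def)
  have "R (xs ! s) (xs ! t) \<longleftrightarrow> P s t" if "s < k" "t < k" "s \<noteq> t" for s t
    using lt[of s t] lt[of t s] that R P by (metis linorder_neqE_nat)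
  then show ?r using len V by (auto simp: in_set_conv_nth)
next
  assume r: ?r
  then show ?l by (auto simp: labelled_copies_def extensions_def)
qed

lemma card_extensions_pos:
  assumes "finite V" "xs \<in> labelled_copies V R P k" "j < k"
  shows "card (extensions V R P (take j xs)) > 0"
  using assms by (auto simp: labelled_copies_def card_gt_0_iff finite_extensions)

section \<open>Adjacency in the double loop graph\<close>

definition loop_adj :: "nat \<Rightarrow> int \<Rightarrow> int \<Rightarrow> bool" where
  "loop_adj k i j \<longleftrightarrow> [j = i + 1] (mod int k) \<or> [j = i - 1] (mod int k) \<or>
     [j = i + 2] (mod int k) \<or> [j = i - 2] (mod int k)"

abbreviation loop_pattern :: "nat \<Rightarrow> nat \<Rightarrow> nat \<Rightarrow> bool" where
  "loop_pattern k s t \<equiv> loop_adj k (int s) (int t)"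

lemma loop_adj_sym: "loop_adj k i j \<Longrightarrow> loop_adj k j i"
proof -
  have "[j = i + c] (mod int k) \<longleftrightarrow> [i = j - c] (mod int k)" for c
    by (auto simp: cong_iff_dvd_diff dvd_diff_commute[of "int k"] algebra_simps)
  from this[of 1] this[of 2] this[of "-1"] this[of "-2"]
  show "loop_adj k i j \<Longrightarrow> loop_adj k j i"
    by (auto simp: loop_adj_def)
qed

text \<open>
  Adjacency depends on the difference of the endpoints modulo \<open>k\<close> up to sign, so it is
  invariant under rotations and reflections.
\<close>

lemma loop_adj_diff:
  assumes "[j - i = j' - i'] (mod int k) \<or> [j - i = i' - j'] (mod int k)"
  shows "loop_adj k i j \<longleftrightarrow> loop_adj k i' j'"
proof -
  have *: "loop_adj k i j \<longleftrightarrow> loop_adj k i' j'" if "[j - i = j' - i'] (mod int k)" for i j i' j'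
  proof -
    have "[j = i + c] (mod int k) \<longleftrightarrow> [j' = i' + c] (mod int k)" for c
    proof -
      have "[j = i + c] (mod int k) \<longleftrightarrow> [j - i = c] (mod int k)"
        by (simp add: cong_iff_dvd_diff algebra_simps)
      also have "\<dots> \<longleftrightarrow> [j' - i' = c] (mod int k)"
        using that by (meson cong_sym cong_trans)
      also have "\<dots> \<longleftrightarrow> [j' = i' + c] (mod int k)"
        by (simp add: cong_iff_dvd_diff algebra_simps)
      finally show ?thesis .
    qed
    from this[of 1] this[of 2] this[of "-1"] this[of "-2"]
    show ?thesis by (simp add: loop_adj_def)
  qed
  show ?thesis using assms *[of j i j' i'] *[of j i i' j'] loop_adj_sym by blast
qed

lemma loop_pattern_less:
  assumes "s < t" "t < k" "k \<ge> 5"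
  shows "loop_pattern k s t \<longleftrightarrow> t \<le> s + 2 \<or> s + k \<le> t + 2"
proof -
  have "int k dvd x \<longleftrightarrow> x = 0 \<or> x = int k" if "x > - int k" "x < 2 * int k" for x
  proof
    assume "int k dvd x"
    then obtain c where c: "x = int k * c" by auto
    have "- 1 * int k < c * int k" "c * int k < 2 * int k"
      using that c by (simp_all add: mult.commute)
    then have "- 1 < c" "c < 2"
      using mult_right_less_imp_less of_nat_0_le_iff by blast+
    then have "c = 0 \<or> c = 1" by linarith
    then show "x = 0 \<or> x = int k" using c by auto
  qed auto
  then have d: "int k dvd int t - (int s + c) \<longleftrightarrow>
      int t - (int s + c) = 0 \<or> int t - (int s + c) = int k" if "\<bar>c\<bar> \<le> 2" for c
    using that assms by simp
  show ?thesis
    using d[of 1] d[of "-1"] d[of 2] d[of "-2"] assms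
    by (auto simp: loop_adj_def cong_iff_dvd_diff)
qed

section \<open>Copies versus labelled copies\<close>

text \<open>
  Fix one isomorphism from the loop graph to each copy. Composing it with the automorphisms
  in \<open>A\<close> gives pairwise different lists: the underlying set recovers the copy, and then
  injectivity of the isomorphism recovers the automorphism.
\<close>

lemma induced_copies_mult_automorphisms_le:
  assumes "graph G" and "k \<ge> 5" and "finite A"
    and A: "\<And>\<sigma>. \<sigma> \<in> A \<Longrightarrow> length \<sigma> = k \<and> set \<sigma> = {..<k} \<and>
      (\<forall>s < k. \<forall>t < k. s \<noteq> t \<longrightarrow> (loop_pattern k (\<sigma> ! s) (\<sigma> ! t) \<longleftrightarrow> loop_pattern k s t))"
  shows "induced_copies (double_loop_graph k 1 2) G * card A
    \<le> card (labelled_copies (verts G) (\<lambda>u v. u \<rightarrow>\<^bsub>G\<^esub> v) (loop_pattern k) k)" (is "_ \<le> card ?L")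
proof -
  interpret G: graph G by fact
  let ?H = "double_loop_graph k 1 2"
  interpret H: graph ?H by (rule graph_double_loop_graph_1_2) fact
  have Gsym: "v \<rightarrow>\<^bsub>G\<^esub> u" if "u \<rightarrow>\<^bsub>G\<^esub> v" for u v
    using G.sym_arcs that by (auto simp: symmetric_def dest: symD)
  define C where "C = {S. S \<subseteq> verts G \<and> card S = card (verts ?H) \<and> digraph_iso (G \<restriction> S) ?H}"
  have "\<exists>h. bij_betw h {..<k} S \<and> (\<forall>s < k. \<forall>t < k. h s \<rightarrow>\<^bsub>G\<^esub> h t \<longleftrightarrow> loop_pattern k s t)"
    if S: "S \<in> C" for S
  proof -
    have "digraph (G \<restriction> S)"
      using S by (intro G.digraphI_induced) (auto simp: C_def)
    then interpret S: digraph "G \<restriction> S" .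
    have "digraph_iso (G \<restriction> S) ?H" using S by (simp add: C_def)
    then obtain f where f: "bij_betw f S (verts ?H)"
      and adj: "\<And>u v. u \<in> S \<Longrightarrow> v \<in> S \<Longrightarrow> u \<rightarrow>\<^bsub>G \<restriction> S\<^esub> v \<longleftrightarrow> f u \<rightarrow>\<^bsub>?H\<^esub> f v"
      using digraph_iso_iff_adjacency[OF S.nomulti_digraph_axioms H.nomulti_digraph_axioms]
      by auto
    have Hv: "verts ?H = {0..<int k}" by (simp add: double_loop_graph_def)
    have Ha: "i \<rightarrow>\<^bsub>?H\<^esub> j \<longleftrightarrow> loop_adj k i j" if "i \<in> {0..<int k}" "j \<in> {0..<int k}" for i j
      using that by (auto simp: double_loop_graph_def loop_adj_def arcs_ends_conv)
    have Sa: "u \<rightarrow>\<^bsub>G \<restriction> S\<^esub> v \<longleftrightarrow> u \<rightarrow>\<^bsub>G\<^esub> v" if "u \<in> S" "v \<in> S" for u v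
      using that by (auto simp: arcs_ends_conv)
    define h where "h = inv_into S f \<circ> int"
    have b1: "bij_betw int {..<k} {0..<int k}"
      by (rule bij_betwI[where g = nat]) auto
    have b2: "bij_betw (inv_into S f) {0..<int k} S"
      using bij_betw_inv_into[OF f] by (simp add: Hv)
    have h: "bij_betw h {..<k} S"
      unfolding h_def using b1 b2 by (rule bij_betw_trans)
    have fh: "f (h t) = int t" "h t \<in> S" if "t < k" for t
      using that bij_betw_inv_into_right[OF f] bij_betwE[OF h] by (auto simp: h_def Hv)
    have "h s \<rightarrow>\<^bsub>G\<^esub> h t \<longleftrightarrow> loop_pattern k s t" if "s < k" "t < k" for s t
      using adj[of "h s" "h t"] Sa[of "h s" "h t"] Ha[of "int s" "int t"] fh that by simp
    with h show ?thesis by blast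
  qed
  then obtain h where bij: "\<And>S. S \<in> C \<Longrightarrow> bij_betw (h S) {..<k} S"
    and adj: "\<And>S s t. S \<in> C \<Longrightarrow> s < k \<Longrightarrow> t < k \<Longrightarrow>
      h S s \<rightarrow>\<^bsub>G\<^esub> h S t \<longleftrightarrow> loop_pattern k s t"
    by metis
  let ?\<Phi> = "\<lambda>(S, \<sigma>). map (h S) \<sigma>"
  have set_eq: "set (?\<Phi> (S, \<sigma>)) = S" if "S \<in> C" "\<sigma> \<in> A" for S \<sigma>
    using bij[OF that(1)] A[OF that(2)] by (simp add: bij_betw_def)
  have "inj_on ?\<Phi> (C \<times> A)"
  proof (rule inj_onI, clarify)
    fix S \<sigma> S' \<sigma>'
    assume m: "S \<in> C" "\<sigma> \<in> A" "S' \<in> C" "\<sigma>' \<in> A" and eq: "map (h S) \<sigma> = map (h S') \<sigma>'"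
    have "S = S'" using set_eq[OF m(1,2)] set_eq[OF m(3,4)] eq by simp
    moreover have "\<sigma> = \<sigma>'"
      using eq \<open>S = S'\<close> bij[OF m(1)] A[OF m(2)] A[OF m(4)]
      by (auto simp: bij_betw_def dest: map_inj_on)
    ultimately show "S = S' \<and> \<sigma> = \<sigma>'" by simp
  qed
  moreover have "?\<Phi> ` (C \<times> A) \<subseteq> ?L"
  proof (clarify)
    fix S \<sigma> assume m: "S \<in> C" "\<sigma> \<in> A"
    have "\<sigma> ! t < k" if "t < k" for t
      using A[OF m(2)] that nth_mem by fastforce
    then show "map (h S) \<sigma> \<in> ?L"
      using set_eq[OF m] m(1) A[OF m(2)] adj[OF m(1)]
      by (subst labelled_copies_iff) (auto simp: C_def intro: loop_adj_sym Gsym)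
  qed
  ultimately have "card (C \<times> A) \<le> card ?L"
    by (intro card_inj_on_le) (auto simp: finite_labelled_copies)
  then show ?thesis
    by (simp add: card_cartesian_product induced_copies_def C_def)
qed

text \<open>
  The automorphisms \<open>t \<mapsto> r + c t\<close> with \<open>c = 1\<close> (rotations) and \<open>c = -1\<close> (reflections).
\<close>

lemma dihedral_mult_copies_le:
  assumes "graph G" and k: "k \<ge> 5"
  shows "2 * k * induced_copies (double_loop_graph k 1 2) G
    \<le> card (labelled_copies (verts G) (\<lambda>u v. u \<rightarrow>\<^bsub>G\<^esub> v) (loop_pattern k) k)"
proof -
  define \<sigma> where "\<sigma> c r = map (\<lambda>t. nat ((int r + c * int t) mod int k)) [0..<k]" for c :: int and r
  have nth: "int (\<sigma> c r ! t) = (int r + c * int t) mod int k" if "t < k" for c r t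
    using that k by (simp add: \<sigma>_def)
  have "inj_on (\<lambda>(c, r). \<sigma> c r) ({1, -1} \<times> {..<k})"
  proof (rule inj_onI, clarify)
    fix c c' :: int and r r' assume c: "c \<in> {1, -1}" "c' \<in> {1, -1}" and r: "r < k" "r' < k"
      and eq: "\<sigma> c r = \<sigma> c' r'"
    have "r = r'" using nth[of 0 c r] nth[of 0 c' r'] eq r k by simp
    have "(int r + c) mod int k = (int r + c') mod int k"
      using nth[of 1 c r] nth[of 1 c' r'] eq k \<open>r = r'\<close> by simp
    then have "int k dvd c - c'"
      by (simp add: mod_eq_dvd_iff)
    then have "c = c'"
      using c k zdvd_not_zless[of 2 "int k"] by auto
    with \<open>r = r'\<close> show "c = c' \<and> r = r'" by simp
  qed
  then have card: "card ((\<lambda>(c, r). \<sigma> c r) ` ({1, -1} \<times> {..<k})) = 2 * k"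
    by (simp add: card_image card_cartesian_product)
  have aut: "length (\<sigma> c r) = k \<and> set (\<sigma> c r) = {..<k} \<and> (\<forall>s < k. \<forall>t < k. s \<noteq> t \<longrightarrow>
      (loop_pattern k (\<sigma> c r ! s) (\<sigma> c r ! t) \<longleftrightarrow> loop_pattern k s t))"
    if c: "c \<in> {1, -1}" for c r
  proof (intro conjI allI impI)
    show len: "length (\<sigma> c r) = k" by (simp add: \<sigma>_def)
    have "s = t" if "s < k" "t < k" "\<sigma> c r ! s = \<sigma> c r ! t" for s t
    proof -
      have "(int r + c * int s) mod int k = (int r + c * int t) mod int k"
        using that nth by metis
      then have "int k dvd c * (int s - int t)"
        by (simp add: mod_eq_dvd_iff algebra_simps)
      then have "int k dvd int s - int t"
        using c by (auto simp: dvd_diff_commute)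
      then have "[s = t] (mod k)" by (simp add: cong_iff_dvd_diff flip: cong_int_iff)
      then show "s = t" using that by (simp add: cong_def)
    qed
    then have "distinct (\<sigma> c r)" by (auto simp: distinct_conv_nth len)
    moreover have "set (\<sigma> c r) \<subseteq> {..<k}"
      using k by (auto simp: \<sigma>_def nat_less_iff)
    ultimately show "set (\<sigma> c r) = {..<k}"
      by (intro card_subset_eq) (auto simp: distinct_card len)
    fix s t assume st: "s < k" "t < k"
    show "loop_pattern k (\<sigma> c r ! s) (\<sigma> c r ! t) \<longleftrightarrow> loop_pattern k s t"
      using c by (intro loop_adj_diff) (auto simp: nth st cong_def mod_diff_eq)
  qed
  show ?thesis
    using induced_copies_mult_automorphisms_le[OF assms, of "(\<lambda>(c, r). \<sigma> c r) ` ({1, -1} \<times> {..<k})"]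
      aut unfolding card by (force simp: mult.commute)
qed

section \<open>The position a vertex can fill along the rotations\<close>

text \<open>
  This linear bound stands in for the inequality of the arithmetic and geometric means: it is
  tight when all \<open>x j\<close> are 1, and it can be summed over several products at once. It comes
  from \<open>exp y \<ge> 1 + y\<close> and \<open>ln x \<le> x - 1\<close>.
\<close>

lemma prod_inverse_ge:
  fixes x :: "'a \<Rightarrow> real"
  assumes "finite J" and "\<And>j. j \<in> J \<Longrightarrow> x j > 0"
  shows "(\<Prod>j \<in> J. 1 / x j) \<ge> 1 + (\<Sum>j \<in> J. 1 - x j)"
proof -
  have "1 + (\<Sum>j \<in> J. 1 - x j) \<le> 1 + (\<Sum>j \<in> J. - ln (x j))"
    using assms(2) ln_le_minus_one by (intro add_left_mono sum_mono) fastforce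
  also have "\<dots> \<le> exp (\<Sum>j \<in> J. - ln (x j))" by simp
  also have "\<dots> = (\<Prod>j \<in> J. 1 / x j)"
    using assms by (simp add: exp_sum exp_minus inverse_eq_divide)
  finally show ?thesis .
qed

lemma sum_periodic_shift:
  fixes f :: "nat \<Rightarrow> 'a :: comm_monoid_add"
  assumes "\<And>r. f (r + k) = f r"
  shows "(\<Sum>r < k. f (r + m)) = (\<Sum>r < k. f r)"
proof (induction m)
  case (Suc m)
  have "(\<Sum>r < k. f (r + Suc m)) = (\<Sum>r < k. f (Suc r + m))" by simp
  also have "\<dots> = (\<Sum>r < k. f (r + m))"
  proof (cases k)
    case (Suc l)
    show ?thesis unfolding Suc
      unfolding sum.lessThan_Suc[of "\<lambda>r. f (Suc r + m)"] sum.lessThan_Suc_shift[of "\<lambda>r. f (r + m)"]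
      using assms[of m] Suc by (simp add: add_ac)
  qed simp
  finally show ?case using Suc by simp
qed simp

text \<open>
  The scale of position \<open>j\<close>. In the intended extremal situation a vertex \<open>w\<close> behaves like
  one vertex of the copy, so it sees four of the \<open>k\<close> vertices and two adjacent pairs of
  consecutive ones: it is admissible in position 1 for four rotations and in position 2 for
  two. The value 2 in position \<open>k - 1\<close> keeps a rotation that matches in positions 1, 2 and
  \<open>k - 1\<close> at \<open>1/4 + 1/2 + 1/2\<close>, so that its excess over 1 is only \<open>1/4\<close>.
\<close>

definition match_scale :: "nat \<Rightarrow> nat \<Rightarrow> real" where
  "match_scale k j = (if j = 1 then 4 else if j = 2 \<or> j = k - 1 then 2 else 1)"

text \<open>
  Here \<open>p\<close> records, around the cycle, which vertices of a copy a given vertex \<open>w\<close> is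
  adjacent to. After the copy is rotated by \<open>r\<close>, the vertex \<open>w\<close> is admissible in position
  \<open>j\<close> if \<open>p\<close> restricted to the window of length \<open>j\<close> starting at \<open>r\<close> is the pattern of
  position \<open>j\<close>.

  For \<open>3 \<le> j \<le> k - 3\<close> the pattern is true in exactly the last two places of the window.
  So \<open>p r\<close> fails, and the first place after \<open>r\<close> where \<open>p\<close> holds determines \<open>j\<close>: at most one
  such \<open>j\<close> occurs. The other positions require \<open>p r\<close> and contribute at most \<open>1/4 + 1/2\<close>,
  except that positions \<open>k - 2\<close> and \<open>k - 1\<close>, where the cycle closes up, can raise this to
  \<open>5/4\<close>. The excess is paid for by another rotation: if position \<open>k - 2\<close> occurs at \<open>r + 4\<close>,
  or position \<open>k - 1\<close> at \<open>r + 2\<close>, then the contribution at \<open>r\<close> is at most \<open>3/4\<close>.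
  Summed over the cycle, these transfers cancel.
\<close>

lemma sum_windows_le:
  fixes p :: "nat \<Rightarrow> bool"
  assumes k: "k \<ge> 7" and per: "\<And>t. p (t + k) = p t"
  shows "(\<Sum>r < k. \<Sum>j = 1..<k.
      of_bool (\<forall>t < j. p (r + t) \<longleftrightarrow> loop_pattern k t j) / match_scale k j) \<le> real k"
proof -
  define m where "m j r \<longleftrightarrow> (\<forall>t < j. p (r + t) \<longleftrightarrow> t + 2 \<ge> j \<or> t + k \<le> j + 2)" for j r
  have m_eq: "(\<forall>t < j. p (r + t) \<longleftrightarrow> loop_pattern k t j) \<longleftrightarrow> m j r" if "j < k" for j r
    using that k by (auto simp: m_def loop_pattern_less)
  define e :: "nat \<Rightarrow> nat \<Rightarrow> real" where "e j r = of_bool (m j r)" for j r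
  have m_in: "p (r + t)" if "m j r" "t < j" "j \<le> t + 2 \<or> t + k \<le> j + 2" for j r t
    using that unfolding m_def by blast
  have m_out: "\<not> p (r + t)" if "m j r" "t + 2 < j" "j + 2 < t + k" for j r t
  proof -
    have "t < j" "\<not> (t + 2 \<ge> j \<or> t + k \<le> j + 2)" using that by linarith+
    then show ?thesis using that(1) unfolding m_def by blast
  qed
  have m1: "m 1 r \<longleftrightarrow> p r" for r
    using k by (auto simp: m_def)
  have m2: "m 2 r \<longleftrightarrow> p r \<and> p (r + 1)" for r
    using k by (auto simp: m_def numeral_2_eq_2 less_Suc_eq)
  have per1: "p (r + k + 1) = p (r + 1)" for r
    using per[of "r + 1"] by (simp add: add_ac)
  \<comment> \<open>\<open>a\<close> and \<open>b\<close> mark the rotations at which the cycle closes up.\<close>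
  define a where "a r \<longleftrightarrow> m (k - 2) r" for r
  define b where "b r \<longleftrightarrow> m (k - 1) r" for r
  have a1: "p r" "\<not> p (r + 1)" "\<not> p (r + 2)" if "a r" for r
  proof -
    have "0 < k - 2" "k - 2 \<le> 0 + 2 \<or> 0 + k \<le> k - 2 + 2" using k by linarith+
    then show "p r" using m_in[of "k - 2" r 0] that by (simp add: a_def)
    show "\<not> p (r + 1)" using m_out[of "k - 2" r 1] that k by (simp add: a_def)
    show "\<not> p (r + 2)" by (rule m_out[of "k - 2"]) (use that k in \<open>auto simp: a_def\<close>)
  qed
  have b1: "p r" "p (r + 1)" "\<not> p (r + 2)" "p (r + (k - 2))" if "b r" for r
  proof -
    show "p r" using m_in[of "k - 1" r 0] that k by (simp add: b_def)
    show "p (r + 1)" using m_in[of "k - 1" r 1] that k by (simp add: b_def)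
    show "\<not> p (r + 2)" by (rule m_out[of "k - 1"]) (use that k in \<open>auto simp: b_def\<close>)
    show "p (r + (k - 2))" by (rule m_in[of "k - 1"]) (use that k in \<open>auto simp: b_def\<close>)
  qed
  have a4: "p r" "p (r + 1)" "\<not> p (r + (k - 2))" if "a (r + 4)" for r
  proof -
    have "p (r + 4 + (k - 4))" by (rule m_in[of "k - 2"]) (use that k in \<open>auto simp: a_def\<close>)
    moreover have "r + 4 + (k - 4) = r + k" using k by linarith
    ultimately show "p r" using per[of r] by metis
    have "p (r + 4 + (k - 3))" by (rule m_in[of "k - 2"]) (use that k in \<open>auto simp: a_def\<close>)
    moreover have "r + 4 + (k - 3) = r + k + 1" using k by linarith
    ultimately show "p (r + 1)" using per1[of r] by metis
    have "\<not> p (r + 4 + (k - 6))" by (rule m_out[of "k - 2"]) (use that k in \<open>auto simp: a_def\<close>)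
    moreover have "r + 4 + (k - 6) = r + (k - 2)" using k by linarith
    ultimately show "\<not> p (r + (k - 2))" by metis
  qed
  have b2: "p r" "p (r + 2)" "\<not> p (r + 4)" if "b (r + 2)" for r
  proof -
    have "p (r + 2 + (k - 2))" by (rule m_in[of "k - 1"]) (use that k in \<open>auto simp: b_def\<close>)
    moreover have "r + 2 + (k - 2) = r + k" using k by linarith
    ultimately show "p r" using per[of r] by metis
    show "p (r + 2)" using b1(1)[OF that] .
    have "\<not> p (r + 2 + 2)" using b1(3)[OF that] .
    moreover have "r + 2 + 2 = r + 4" by linarith
    ultimately show "\<not> p (r + 4)" by metis
  qed
  \<comment> \<open>The middle positions exclude one another: the last place but one of the shorter
    window would have to be false for the longer one.\<close>
  have mid: "(\<Sum>j = 3..<k - 2. e j r) \<le> of_bool (\<not> p r)" for r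
  proof (cases "\<exists>j \<in> {3..<k - 2}. m j r")
    case True
    then obtain j where j: "j \<in> {3..<k - 2}" "m j r" by blast
    have uniq: "i = j" if "i \<in> {3..<k - 2}" "m i r" for i
    proof (rule ccontr)
      have less: False if m: "m i r" "m j r" and ij: "3 \<le> i" "i < j" "j < k - 2" for i j
      proof -
        have "i - 2 < i" "i \<le> i - 2 + 2 \<or> i - 2 + k \<le> i + 2" "i - 2 + 2 < j" "j + 2 < i - 2 + k"
          using ij by linarith+
        then show False using m_in[OF m(1)] m_out[OF m(2)] by blast
      qed
      have bounds: "3 \<le> i" "i < k - 2" "3 \<le> j" "j < k - 2" using that j by auto
      assume "i \<noteq> j"
      then have "i < j \<or> j < i" by (rule nat_neq_iff[THEN iffD1])
      then show False
      proof
        assume "i < j"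
        then show False by (rule less[OF that(2) j(2) bounds(1) _ bounds(4)])
      next
        assume "j < i"
        then show False by (rule less[OF j(2) that(2) bounds(3) _ bounds(2)])
      qed
    qed
    have "(\<Sum>i = 3..<k - 2. e i r) = (\<Sum>i \<in> {j}. e i r)"
      using j(1) by (intro sum.mono_neutral_right) (auto simp: e_def dest: uniq[rotated])
    moreover have "3 \<le> j" "j < k - 2" using j(1) by auto
    then have "0 + 2 < j" "j + 2 < 0 + k" by linarith+
    then have "\<not> p r" using m_out[OF j(2), of 0] by simp
    moreover have "e j r \<le> 1" by (simp add: e_def)
    ultimately show ?thesis by simp
  next
    case False
    then have "(\<Sum>j = 3..<k - 2. e j r) = 0"
      by (intro sum.neutral) (auto simp: e_def)
    then show ?thesis by simp
  qed
  \<comment> \<open>Each rotation that closes up receives \<open>1/4\<close> from the rotation 4 or 2 places before.\<close>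
  have cost: "(\<Sum>j = 1..<k. e j r / match_scale k j) \<le>
      1 + (of_bool (a r) + of_bool (b r) - of_bool (a (r + 4)) - of_bool (b (r + 2))) / 4" for r
  proof -
    define F where "F j = e j r / match_scale k j" for j
    have "sum F {1..<k} = sum F {1..<3} + sum F {3..<k - 2} + sum F {k - 2..<k}"
      using k by (simp add: sum.atLeastLessThan_concat)
    moreover have "{1..<3} = {1, 2::nat}" by auto
    moreover have "{k - 2..<k} = {k - 2, k - 1}" using k by auto
    moreover have "sum F {3..<k - 2} = (\<Sum>j = 3..<k - 2. e j r)"
      by (intro sum.cong) (auto simp: F_def match_scale_def)
    moreover have neq: "k - 2 \<noteq> 1" "k - 2 \<noteq> 2" "k - 2 \<noteq> k - 1" using k by linarith+
    moreover have "F 1 = e 1 r / 4" "F 2 = e 2 r / 2" by (simp_all add: F_def match_scale_def)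
    moreover have "F (k - 2) = e (k - 2) r" using neq by (simp add: F_def match_scale_def)
    moreover have "k - 1 \<noteq> 1" using k by linarith
    then have "F (k - 1) = e (k - 1) r / 2" by (simp add: F_def match_scale_def)
    ultimately have "sum F {1..<k}
        = e 1 r / 4 + e 2 r / 2 + (\<Sum>j = 3..<k - 2. e j r) + e (k - 2) r + e (k - 1) r / 2"
      by simp
    then have "(\<Sum>j = 1..<k. e j r / match_scale k j)
        = e 1 r / 4 + e 2 r / 2 + (\<Sum>j = 3..<k - 2. e j r) + e (k - 2) r + e (k - 1) r / 2"
      by (simp only: F_def[abs_def])
    also have "\<dots> \<le> of_bool (p r) / 4 + of_bool (p r \<and> p (r + 1)) / 2 + of_bool (\<not> p r)
        + of_bool (a r) + of_bool (b r) / 2"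
      using mid[of r] m1[of r] m2[of r] by (simp add: e_def a_def b_def)
    also have "\<dots> \<le>
      1 + (of_bool (a r) + of_bool (b r) - of_bool (a (r + 4)) - of_bool (b (r + 2))) / 4"
    proof (cases "p r")
      case False
      then have "\<not> a r" "\<not> b r" "\<not> a (r + 4)" "\<not> b (r + 2)"
        using a1(1) b1(1) a4(1) b2(1) by blast+
      with False show ?thesis by simp
    next
      case True
      consider "a (r + 4)" | "b (r + 2)" | "\<not> a (r + 4)" "\<not> b (r + 2)" by blast
      then show ?thesis
      proof cases
        case 1
        have "\<not> a r" "\<not> b r" "\<not> b (r + 2)"
          using 1 a4(2,3) a1(1,2) b1(4) b2(3) by blast+
        with True 1 show ?thesis by simp
      next
        case 2
        have "\<not> a r" "\<not> b r" "\<not> a (r + 4)"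
          using 2 b2(2,3) a1(1,3) b1(3) by blast+
        with True 2 show ?thesis by simp
      next
        case 3
        consider "a r" "\<not> b r" "\<not> p (r + 1)" | "b r" "\<not> a r" | "\<not> a r" "\<not> b r"
          using a1(2) b1(2) by blast
        then show ?thesis using 3 True by cases auto
      qed
    qed
    finally show ?thesis .
  qed
  have perm: "m j (r + k) = m j r" for j r
    using per by (simp add: m_def add.commute add.left_commute) (metis add.assoc add.commute)
  have "(\<Sum>r < k. \<Sum>j = 1..<k.
      of_bool (\<forall>t < j. p (r + t) \<longleftrightarrow> loop_pattern k t j) / match_scale k j)
    = (\<Sum>r < k. \<Sum>j = 1..<k. e j r / match_scale k j)"
    by (intro sum.cong) (auto simp: e_def m_eq)
  also have "\<dots> \<le> (\<Sum>r < k.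
      1 + (of_bool (a r) + of_bool (b r) - of_bool (a (r + 4)) - of_bool (b (r + 2))) / 4)"
    by (intro sum_mono cost)
  also have "\<dots> = real k + ((\<Sum>r < k. of_bool (a r)) + (\<Sum>r < k. of_bool (b r))
      - (\<Sum>r < k. of_bool (a (r + 4))) - (\<Sum>r < k. of_bool (b (r + 2)))) / 4"
    by (simp add: sum.distrib sum_subtractf flip: sum_divide_distrib)
  also have "\<dots> = real k"
    using sum_periodic_shift[of "\<lambda>r. of_bool (a r) :: real" k 4]
      sum_periodic_shift[of "\<lambda>r. of_bool (b r) :: real" k 2]
    by (simp add: a_def b_def perm)
  finally show ?thesis .
qed

section \<open>Orders at least seven\<close>

lemma rotate_labelled_loop_copies:
  assumes R: "\<And>u v. R u v \<Longrightarrow> R v u"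
    and xs: "xs \<in> labelled_copies V R (loop_pattern k) k"
  shows "rotate r xs \<in> labelled_copies V R (loop_pattern k) k"
proof -
  note iff = labelled_copies_iff[of R "loop_pattern k", OF R loop_adj_sym]
  have len: "length xs = k" and V: "set xs \<subseteq> V"
    and adj: "\<And>s t. s < k \<Longrightarrow> t < k \<Longrightarrow> s \<noteq> t \<Longrightarrow> R (xs ! s) (xs ! t) \<longleftrightarrow> loop_pattern k s t"
    using xs by (auto simp: iff)
  have "R (rotate r xs ! s) (rotate r xs ! t) \<longleftrightarrow> loop_pattern k s t"
    if st: "s < k" "t < k" "s \<noteq> t" for s t
  proof -
    have "(r + s) mod k \<noteq> (r + t) mod k"
    proof
      assume "(r + s) mod k = (r + t) mod k"
      then have "[s = t] (mod k)" by (simp add: cong_add_lcancel_nat flip: cong_def)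
      then show False using st by (simp add: cong_def)
    qed
    moreover have "loop_pattern k ((r + s) mod k) ((r + t) mod k) \<longleftrightarrow> loop_pattern k s t"
      by (rule loop_adj_diff) (simp add: cong_def of_nat_mod mod_diff_eq)
    ultimately show ?thesis
      using adj[of "(r + s) mod k" "(r + t) mod k"] st len by (simp add: nth_rotate)
  qed
  then show ?thesis using len V by (auto simp: iff)
qed

text \<open>
  Write the weight of each rotation as a product over the positions \<open>j \<ge> 1\<close> of \<open>1 / x j r\<close>,
  where \<open>x\<close> is the number of admissible vertices, scaled so that its average over all
  rotations and positions is at most 1. Each vertex of \<open>G\<close> contributes to that average what
  \<open>sum_windows_le\<close> bounds, and \<open>prod_inverse_ge\<close> turns the bound on the average into the lower
  bound \<open>k\<close> for the sum of the products.
\<close>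

lemma sum_greedy_weight_rotations_ge:
  assumes fin: "finite V" and k: "k \<ge> 7" and R: "\<And>u v. R u v \<Longrightarrow> R v u"
    and xs: "xs \<in> labelled_copies V R (loop_pattern k) k"
  shows "real k ^ k / (54 * real (card V) ^ k)
    \<le> (\<Sum>r < k. greedy_weight V R (loop_pattern k) (rotate r xs))"
proof -
  define n where "n = real (card V)"
  let ?ext = "extensions V R (loop_pattern k)"
  define N where "N j r = real (card (?ext (take j (rotate r xs))))" for j r
  define x where "x j r = real (k - 1) / n * (N j r / match_scale k j)" for j r
  have len: "length xs = k" using xs by (simp add: labelled_copies_def)
  have Npos: "N j r > 0" if "j < k" for j r
    using card_extensions_pos[OF fin rotate_labelled_loop_copies[OF R xs, of r] that]
    by (simp add: N_def)
  have N0: "N 0 r = n" for r by (simp add: N_def n_def extensions_def)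
  have n: "n > 0" using Npos[of 0 0] N0[of 0] k by simp
  have cpos: "match_scale k j > 0" for j by (simp add: match_scale_def)
  have xpos: "x j r > 0" if "j \<in> {1..<k}" for j r
    unfolding x_def using n k cpos Npos that by simp
  have prod_cost: "(\<Prod>j = 1..<k. match_scale k j) = 16"
  proof -
    have "{1..<k} = {3..<k - 1} \<union> {1, 2, k - 1}" using k by auto
    moreover have "(\<Prod>j = 3..<k - 1. match_scale k j) = 1"
      by (intro prod.neutral) (auto simp: match_scale_def)
    ultimately show ?thesis
      using k by (simp add: prod.union_disjoint) (simp add: match_scale_def)
  qed
  have weight: "greedy_weight V R (loop_pattern k) (rotate r xs)
      = (real (k - 1) / n) ^ (k - 1) / (16 * n) * (\<Prod>j = 1..<k. 1 / x j r)" for r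
  proof -
    have "{..<k} = insert 0 {1..<k}" using k by auto
    then have "greedy_weight V R (loop_pattern k) (rotate r xs) = 1 / n * (\<Prod>j = 1..<k. 1 / N j r)"
      by (simp add: greedy_weight_def len N_def[symmetric] N0)
    moreover have "(\<Prod>j = 1..<k. 1 / x j r)
        = (\<Prod>j = 1..<k. n / real (k - 1) * match_scale k j * (1 / N j r))"
      by (intro prod.cong) (auto simp: x_def)
    moreover have "\<dots> = (n / real (k - 1)) ^ (k - 1) * 16 * (\<Prod>j = 1..<k. 1 / N j r)"
      by (simp only: prod.distrib prod_cost prod_constant card_atLeastLessThan)
    ultimately show ?thesis
      using n k by (simp add: power_divide field_simps)
  qed
  have sumN: "(\<Sum>r < k. \<Sum>j = 1..<k. N j r / match_scale k j) \<le> n * real k"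
  proof -
    have Nsum: "N j r = (\<Sum>w \<in> V. of_bool (\<forall>t < j. R (xs ! ((r + t) mod k)) w \<longleftrightarrow> loop_pattern k t j))"
      if "j \<in> {1..<k}" for j r
    proof -
      have "?ext (take j (rotate r xs))
          = {w \<in> V. \<forall>t < j. R (xs ! ((r + t) mod k)) w \<longleftrightarrow> loop_pattern k t j}"
        using that len by (auto simp: extensions_def nth_rotate)
      then show ?thesis using fin by (simp add: N_def sum.If_cases of_bool_def Int_def)
    qed
    have "(\<Sum>r < k. \<Sum>j = 1..<k. N j r / match_scale k j)
      = (\<Sum>r < k. \<Sum>j = 1..<k. \<Sum>w \<in> V.
          of_bool (\<forall>t < j. R (xs ! ((r + t) mod k)) w \<longleftrightarrow> loop_pattern k t j) / match_scale k j)"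
      by (intro sum.cong) (simp_all add: Nsum sum_divide_distrib)
    also have "\<dots> = (\<Sum>w \<in> V. \<Sum>r < k. \<Sum>j = 1..<k.
          of_bool (\<forall>t < j. R (xs ! ((r + t) mod k)) w \<longleftrightarrow> loop_pattern k t j) / match_scale k j)"
      by (subst sum.swap[of _ V], subst sum.swap[of _ V]) (rule refl)
    also have "\<dots> \<le> (\<Sum>w \<in> V. real k)"
      by (intro sum_mono sum_windows_le[OF k]) simp
    finally show ?thesis by (simp add: n_def)
  qed
  have "real k \<le> (\<Sum>r < k. 1 + (\<Sum>j = 1..<k. 1 - x j r))"
  proof -
    have "(\<Sum>r < k. \<Sum>j = 1..<k. x j r)
        = real (k - 1) / n * (\<Sum>r < k. \<Sum>j = 1..<k. N j r / match_scale k j)"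
      by (simp add: x_def sum_distrib_left)
    also have "\<dots> \<le> real (k - 1) / n * (n * real k)"
      using n by (intro mult_left_mono sumN) simp
    also have "\<dots> = real (k - 1) * real k" using n by simp
    finally have "(\<Sum>r < k. \<Sum>j = 1..<k. x j r) \<le> real (k - 1) * real k" .
    moreover have "(\<Sum>r < k. 1 + (\<Sum>j = 1..<k. 1 - x j r))
        = real k + real (k - 1) * real k - (\<Sum>r < k. \<Sum>j = 1..<k. x j r)"
      by (simp only: sum.distrib sum_subtractf sum_constant card_atLeastLessThan card_lessThan)
        (simp add: mult.commute)
    ultimately show ?thesis by linarith
  qed
  also have "\<dots> \<le> (\<Sum>r < k. \<Prod>j = 1..<k. 1 / x j r)"
    by (intro sum_mono prod_inverse_ge xpos) simp
  finally have main: "real k \<le> (\<Sum>r < k. \<Prod>j = 1..<k. 1 / x j r)" .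
  \<comment> \<open>The scales multiply to 16, and \<open>27 / 8 = 54 / 16\<close> leaves just enough room for
    \<open>(1 + 1 / (k - 1)) ^ (k - 1) \<le> exp 1 \<le> 3\<close>.\<close>
  have euler: "real k ^ (k - 1) \<le> 27 / 8 * real (k - 1) ^ (k - 1)"
  proof -
    have "real k / real (k - 1) = 1 + 1 / real (k - 1)" using k by (simp add: field_simps)
    also have "\<dots> \<le> exp (1 / real (k - 1))" by simp
    finally have "(real k / real (k - 1)) ^ (k - 1) \<le> exp (1 / real (k - 1)) ^ (k - 1)"
      by (intro power_mono) auto
    also have "\<dots> = exp 1" using k by (simp flip: exp_of_nat_mult)
    also have "\<dots> \<le> 27 / 8" using exp_le by simp
    finally show ?thesis using k by (simp add: power_divide divide_le_eq)
  qed
  have kk: "real k ^ k = real k * real k ^ (k - 1)" "n ^ k = n * n ^ (k - 1)"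
    using k by (simp_all flip: power_Suc)
  have "real k ^ k / (54 * n ^ k) = real k * (real k ^ (k - 1) / (54 * n ^ k))"
    by (simp add: kk)
  also have "\<dots> \<le> real k * (27 / 8 * real (k - 1) ^ (k - 1) / (54 * n ^ k))"
    using n by (intro mult_left_mono divide_right_mono euler) auto
  also have "\<dots> = (real (k - 1) / n) ^ (k - 1) / (16 * n) * real k"
    using n by (simp add: kk power_divide mult_ac)
  also have "\<dots> \<le> (real (k - 1) / n) ^ (k - 1) / (16 * n) * (\<Sum>r < k. \<Prod>j = 1..<k. 1 / x j r)"
    using n by (intro mult_left_mono main) auto
  also have "\<dots> = (\<Sum>r < k. greedy_weight V R (loop_pattern k) (rotate r xs))"
    by (simp add: weight sum_distrib_left)
  finally show ?thesis by (simp add: n_def)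
qed

text \<open>
  Double counting: summed over all lists and all rotations, the weights total at most \<open>k\<close>,
  because each rotation permutes the lists.
\<close>

lemma card_labelled_loop_copies_le:
  assumes fin: "finite V" and k: "k \<ge> 7" and R: "\<And>u v. R u v \<Longrightarrow> R v u"
  shows "real (card (labelled_copies V R (loop_pattern k) k)) * real k ^ k
    \<le> 54 * real k * real (card V) ^ k"
proof -
  let ?L = "labelled_copies V R (loop_pattern k) k"
  let ?W = "greedy_weight V R (loop_pattern k)"
  have finL: "finite ?L" using fin by (rule finite_labelled_copies)
  show ?thesis
  proof (cases "?L = {}")
    case False
    then obtain ys where "ys \<in> ?L" by blast
    then have "ys ! 0 \<in> V" using k by (auto simp: labelled_copies_def extensions_def)
    then have n: "card V > 0" using fin by (auto simp: card_gt_0_iff)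
    have rot: "(\<Sum>xs \<in> ?L. ?W (rotate r xs)) \<le> 1" for r
    proof -
      have inj: "inj_on (rotate r) ?L"
        unfolding rotate_def by (rule inj_on_subset[OF inj_fn[OF inj_rotate1]]) simp
      have "(\<Sum>xs \<in> ?L. ?W (rotate r xs)) = (\<Sum>xs \<in> rotate r ` ?L. ?W xs)"
        by (simp add: sum.reindex[OF inj])
      also have "\<dots> \<le> (\<Sum>xs \<in> ?L. ?W xs)"
        using rotate_labelled_loop_copies[OF R]
        by (intro sum_mono2 finL) (auto simp: greedy_weight_nonneg)
      also have "\<dots> \<le> 1" using fin by (rule sum_greedy_weight_le_1)
      finally show ?thesis .
    qed
    have "real (card ?L) * (real k ^ k / (54 * real (card V) ^ k))
        = (\<Sum>xs \<in> ?L. real k ^ k / (54 * real (card V) ^ k))" by simp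
    also have "\<dots> \<le> (\<Sum>xs \<in> ?L. \<Sum>r < k. ?W (rotate r xs))"
      by (rule sum_mono) (rule sum_greedy_weight_rotations_ge[OF fin k R])
    also have "\<dots> = (\<Sum>r < k. \<Sum>xs \<in> ?L. ?W (rotate r xs))" by (rule sum.swap)
    also have "\<dots> \<le> (\<Sum>r < k. 1)" by (intro sum_mono rot)
    finally have "real (card ?L) * real k ^ k / (54 * real (card V) ^ k) \<le> real k" by simp
    moreover have "0 < 54 * real (card V) ^ k" using n by simp
    ultimately have "real (card ?L) * real k ^ k \<le> real k * (54 * real (card V) ^ k)"
      by (simp only: pos_divide_le_eq)
    then show ?thesis by (simp only: mult_ac)
  qed simp
qed

section \<open>Orders five and six\<close>

text \<open>
  The maximum is attained at \<open>q = 2 d / 3\<close>, hence the square in the factorisation.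
\<close>

lemma cubic_le:
  fixes q d :: real
  assumes "0 \<le> q" "0 \<le> d"
  shows "27 * (q\<^sup>2 * (d - q)) \<le> 4 * d ^ 3"
proof -
  have "4 * d ^ 3 - 27 * (q\<^sup>2 * (d - q)) = (2 * d - 3 * q)\<^sup>2 * (d + 3 * q)"
    by (simp add: power2_eq_square power3_eq_cube algebra_simps)
  also have "\<dots> \<ge> 0" using assms by simp
  finally show ?thesis by simp
qed

text \<open>
  The double loop graph of order 6 is the octahedron: only opposite vertices are not adjacent.
\<close>

lemma loop_pattern_6: "i < 6 \<Longrightarrow> j < 6 \<Longrightarrow> loop_pattern 6 i j \<longleftrightarrow> i mod 3 \<noteq> j mod 3"
proof -
  have "\<forall>i \<in> set [0..<6]. \<forall>j \<in> set [0..<6]. loop_pattern 6 i j \<longleftrightarrow> i mod 3 \<noteq> j mod 3"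
    unfolding loop_adj_def cong_def by code_simp
  then show "i < 6 \<Longrightarrow> j < 6 \<Longrightarrow> ?thesis" by simp
qed

text \<open>
  With \<open>d\<close> the degree of the first vertex and \<open>q\<close> the number of common neighbours of the
  first two, the six choices number at most \<open>n\<close>, \<open>d\<close>, \<open>q\<close>, \<open>n - d\<close>, \<open>d - q\<close> and \<open>q\<close>, since
  opposite vertices are not adjacent. Their product is largest when \<open>q = 2 d / 3\<close>; the
  remaining powers of \<open>d\<close> are estimated crudely, as \<open>(4 / 27) ^ 2 \<le> 1 / 36\<close> leaves room.
\<close>

lemma greedy_weight_octahedron_ge:
  assumes fin: "finite V" and xs: "xs \<in> labelled_copies V R (loop_pattern 6) 6"
  shows "36 / real (card V) ^ 6 \<le> greedy_weight V R (loop_pattern 6) xs"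
proof -
  let ?ext = "extensions V R (loop_pattern 6)"
  define n where "n = real (card V)"
  define N where "N j = real (card (?ext (take j xs)))" for j
  have len: "length xs = 6" using xs by (simp add: labelled_copies_def)
  have Npos: "N j > 0" if "j < 6" for j
    using card_extensions_pos[OF fin xs that] by (simp add: N_def)
  define A where "A = {w \<in> V. R (xs ! 0) w}"
  define B where "B = {w \<in> A. R (xs ! 1) w}"
  define d where "d = real (card A)"
  define q where "q = real (card B)"
  have AV: "A \<subseteq> V" "B \<subseteq> A" by (auto simp: A_def B_def)
  have finA: "finite A" "finite B" using fin by (simp_all add: A_def B_def)
  have ext: "?ext (take j xs) = {w \<in> V. \<forall>t < j. R (xs ! t) w \<longleftrightarrow> t mod 3 \<noteq> j mod 3}" if "j < 6" for j
    using that len by (auto simp: extensions_def loop_pattern_6)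
  have N: "N 0 = n" "N 1 = d" "N 2 = q"
    using ext[of 0] ext[of 1] ext[of 2]
    by (auto simp: N_def n_def d_def q_def A_def B_def numeral_2_eq_2 less_Suc_eq intro!: arg_cong[where f = card])
  have "?ext (take 3 xs) \<subseteq> V - A" "?ext (take 4 xs) \<subseteq> A - B" "?ext (take 5 xs) \<subseteq> B"
    using ext[of 3] ext[of 4] ext[of 5] by (auto simp: A_def B_def)
  then have "N 3 \<le> real (card (V - A))" "N 4 \<le> real (card (A - B))" "N 5 \<le> real (card B)"
    using fin finA by (auto simp: N_def intro!: card_mono)
  then have N': "N 3 \<le> n - d" "N 4 \<le> d - q" "N 5 \<le> q"
    using AV finA fin
    by (simp_all add: card_Diff_subset n_def d_def q_def of_nat_diff card_mono)
  have pos: "0 < n" "0 < d" "0 < q" "0 < d - q" "0 < n - d"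
    using N N' Npos[of 0] Npos[of 1] Npos[of 2] Npos[of 3] Npos[of 4] by auto
  have "(\<Prod>j < 6. N j) = n * d * q * N 3 * N 4 * N 5"
    by (simp add: lessThan_nat_numeral lessThan_Suc N mult_ac numeral_eq_Suc)
       (simp add: N[unfolded numeral_eq_Suc One_nat_def, simplified])
  also have "\<dots> \<le> n * d * q * (n - d) * (d - q) * q"
    using pos N' Npos[of 3] Npos[of 4] Npos[of 5] by (intro mult_mono) auto
  also have "\<dots> = n * (d * (n - d)) * (q\<^sup>2 * (d - q))"
    by (simp add: power2_eq_square mult_ac)
  also have "\<dots> \<le> n * (d * (n - d)) * (4 / 27 * d ^ 3)"
    using cubic_le[of q d] pos by (intro mult_left_mono) auto
  also have "\<dots> = 4 / 27 * n * d\<^sup>2 * (d\<^sup>2 * (n - d))"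
    by (simp add: power2_eq_square power3_eq_cube mult_ac)
  also have "\<dots> \<le> 4 / 27 * n * n\<^sup>2 * (4 / 27 * n ^ 3)"
  proof (rule mult_mono)
    show "4 / 27 * n * d\<^sup>2 \<le> 4 / 27 * n * n\<^sup>2"
      using pos by (intro mult_left_mono power_mono) auto
    show "d\<^sup>2 * (n - d) \<le> 4 / 27 * n ^ 3" using cubic_le[of d n] pos by simp
  qed (use pos in auto)
  also have "\<dots> \<le> n ^ 6 / 36"
    using pos by (simp add: power2_eq_square power3_eq_cube eval_nat_numeral)
  finally have "(\<Prod>j < 6. N j) \<le> n ^ 6 / 36" .
  moreover have "(\<Prod>j < 6. N j) > 0" using Npos by (intro prod_pos) auto
  ultimately have "36 / n ^ 6 \<le> 1 / (\<Prod>j < 6. N j)"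
    using pos by (simp add: field_simps)
  also have "\<dots> = greedy_weight V R (loop_pattern 6) xs"
    by (simp add: greedy_weight_def len N_def prod_dividef)
  finally show ?thesis by (simp add: n_def)
qed

text \<open>
  A vertex, a vertex outside its antipodal pair and a vertex of the third pair determine an
  automorphism of the octahedron.
\<close>

definition octahedron_automorphisms :: "nat list list" where
  "octahedron_automorphisms =
     [[a, b, c, (a + 3) mod 6, (b + 3) mod 6, (c + 3) mod 6].
        a \<leftarrow> [0..<6], b \<leftarrow> [0..<6], c \<leftarrow> [0..<6], distinct [a mod 3, b mod 3, c mod 3]]"

lemma card_octahedron_automorphisms: "card (set octahedron_automorphisms) = 48"
  by code_simp

lemma octahedron_automorphisms:
  "\<forall>\<sigma> \<in> set octahedron_automorphisms. length \<sigma> = 6 \<and> set \<sigma> = set [0..<6] \<and>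
     (\<forall>s \<in> set [0..<6]. \<forall>t \<in> set [0..<6]. \<sigma> ! s mod 3 = \<sigma> ! t mod 3 \<longleftrightarrow> s mod 3 = t mod 3)"
  by code_simp

text \<open>
  The twelve dihedral symmetries do not suffice here, so all 48 automorphisms are used: in a
  balanced complete tripartite graph each copy is produced by the random process in 48 ways.
  The constant arises as \<open>48 * 36 = 6 ^ 6 / 27\<close>.
\<close>

lemma induced_octahedra_le:
  assumes G: "graph G"
  shows "real (induced_copies (double_loop_graph 6 1 2) G) \<le> 27 * real (card (verts G)) ^ 6 / 6 ^ 6"
proof -
  interpret G: graph G by fact
  let ?N = "induced_copies (double_loop_graph 6 1 2) G"
  let ?R = "\<lambda>u v. u \<rightarrow>\<^bsub>G\<^esub> v"
  let ?L = "labelled_copies (verts G) ?R (loop_pattern 6) 6"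
  define n where "n = real (card (verts G))"
  have "?N * card (set octahedron_automorphisms) \<le> card ?L"
  proof (rule induced_copies_mult_automorphisms_le[OF G])
    fix \<sigma> assume "\<sigma> \<in> set octahedron_automorphisms"
    then have \<sigma>: "length \<sigma> = 6" "set \<sigma> = {..<6}"
      and mod3: "\<And>s t. s < 6 \<Longrightarrow> t < 6 \<Longrightarrow> \<sigma> ! s mod 3 = \<sigma> ! t mod 3 \<longleftrightarrow> s mod 3 = t mod 3"
      using octahedron_automorphisms by (auto simp: atLeast0LessThan)
    have "\<sigma> ! s < 6" if "s < 6" for s
      using nth_mem[of s \<sigma>] \<sigma> that by auto
    then show "length \<sigma> = 6 \<and> set \<sigma> = {..<6} \<and>
      (\<forall>s < 6. \<forall>t < 6. s \<noteq> t \<longrightarrow> (loop_pattern 6 (\<sigma> ! s) (\<sigma> ! t) \<longleftrightarrow> loop_pattern 6 s t))"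
      using \<sigma> mod3 by (simp add: loop_pattern_6)
  qed auto
  then have N: "real ?N * 48 \<le> real (card ?L)"
    unfolding card_octahedron_automorphisms by linarith
  have "real (card ?L) * (36 / n ^ 6) = (\<Sum>xs \<in> ?L. 36 / n ^ 6)" by simp
  also have "\<dots> \<le> (\<Sum>xs \<in> ?L. greedy_weight (verts G) ?R (loop_pattern 6) xs)"
    unfolding n_def by (intro sum_mono greedy_weight_octahedron_ge) auto
  also have "\<dots> \<le> 1" by (intro sum_greedy_weight_le_1) simp
  finally have L: "real (card ?L) * (36 / n ^ 6) \<le> 1" .
  show ?thesis
  proof (cases "n = 0")
    case True
    then have "verts G = {}" by (simp add: n_def)
    then have "?L = {}" by (auto simp: labelled_copies_def extensions_def intro!: exI[of _ 0])
    then show ?thesis using N by (simp add: n_def)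
  next
    case False
    then have "n > 0" by (simp add: n_def card_gt_0_iff)
    then have "real (card ?L) * 36 \<le> n ^ 6" using L by (simp add: field_simps)
    then show ?thesis using N by (simp add: n_def)
  qed
qed

text \<open>
  The double loop graph of order 5 is complete, and already the number of 5-element sets is
  small enough, because \<open>1 / 5! \<le> 27 / 5 ^ 5\<close>.
\<close>

lemma induced_K5_le:
  assumes G: "graph G"
  shows "real (induced_copies (double_loop_graph 5 1 2) G) \<le> 27 * real (card (verts G)) ^ 5 / 5 ^ 5"
proof -
  interpret G: graph G by fact
  let ?n = "card (verts G)"
  let ?N = "induced_copies (double_loop_graph 5 1 2) G"
  have "?N \<le> card {S. S \<subseteq> verts G \<and> card S = 5}"
    unfolding induced_copies_def card_verts_double_loop_graph
    by (rule card_mono) auto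
  also have "\<dots> = ?n choose 5" by (intro n_subsets) simp
  finally have "?N * fact 5 \<le> ?n ^ 5"
    using binomial_fact_pow[of ?n 5] by (meson dual_order.trans mult_le_mono1)
  moreover have "(fact 5 :: nat) = 120" by (simp add: fact_numeral)
  ultimately have "?N * 120 \<le> ?n ^ 5" by metis
  then have "real (?N * 120) \<le> real (?n ^ 5)" by (rule of_nat_mono)
  then have "real ?N * 120 \<le> real ?n ^ 5" by simp
  then show ?thesis by simp
qed

section \<open>The bound for all orders\<close>

theorem theorem4:
  fixes G :: "('a, 'b) pre_digraph" and k n :: nat
  assumes "k \<ge> 5"
    and "graph G"
    and "card (verts G) = n"
  shows "real (induced_copies (double_loop_graph k 1 2) G) \<le> 27 * real n ^ k / real k ^ k"
proof -
  interpret G: graph G by fact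
  consider "k = 5" | "k = 6" | "k \<ge> 7" using assms(1) by linarith
  then show ?thesis
  proof cases
    case 1
    then show ?thesis using induced_K5_le[OF assms(2)] assms(3) by simp
  next
    case 2
    then show ?thesis using induced_octahedra_le[OF assms(2)] assms(3) by simp
  next
    case 3
    let ?N = "induced_copies (double_loop_graph k 1 2) G"
    let ?L = "labelled_copies (verts G) (\<lambda>u v. u \<rightarrow>\<^bsub>G\<^esub> v) (loop_pattern k) k"
    have "2 * real k * real ?N \<le> real (card ?L)"
      using of_nat_mono[OF dihedral_mult_copies_le[OF assms(2,1)], where 'a = real] by simp
    then have "2 * real k * real ?N * real k ^ k \<le> real (card ?L) * real k ^ k"
      by (intro mult_right_mono) auto
    also have "\<dots> \<le> 54 * real k * real n ^ k"
      using card_labelled_loop_copies_le[OF G.finite_verts 3, of "\<lambda>u v. u \<rightarrow>\<^bsub>G\<^esub> v"]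
        G.sym_arcs assms(3) by (auto simp: symmetric_def dest: symD)
    finally have "(2 * real k) * (real ?N * real k ^ k) \<le> (2 * real k) * (27 * real n ^ k)"
      by (simp add: mult_ac)
    then have "real ?N * real k ^ k \<le> 27 * real n ^ k"
      using 3 by (simp add: mult_le_cancel_left_pos mult.commute)
    then show ?thesis using 3 by (simp add: pos_le_divide_eq)
  qed
qed

end
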